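(* Let $A$ be a positive rational number and $n \ge 2$ a natural number such that $\sqrt[n]{A}$ is an irreducible radical. Let $a$ and $b$ be rational numbers with $b \neq 0$. Then $a + b\sqrt[n]{A}$ is not a root of any nonzero polynomial with rational coefficients of degree less than $n$.
   Context: Natural numbers are the positive integers, and $\sqrt[n]{A}$ denotes the positive real $n$-th root. For a positive rational number $A$ and a natural number $n \ge 2$, the radical $\sqrt[n]{A}$ is called irreducible if there do not exist a natural number $m < n$ (with $m=1$ allowed, $\sqrt[1]{B}=B$) and a positive rational number $B$ such that $\sqrt[n]{A} = \sqrt[m]{B}$. *)

theory Defs
  imports Complex_Main "HOL-Computational_Algebra.Polynomial"
begin

(* Meaningful for A > 0 and n >= 2; the natural numbers of the source start at 1. *)
definition irreducible_radical :: "nat \<Rightarrow> rat \<Rightarrow> bool" where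
  "irreducible_radical n A \<longleftrightarrow>
     \<not> (\<exists>m B. 1 \<le> m \<and> m < n \<and> (0::rat) < B \<and> root n (real_of_rat A) = root m (real_of_rat B))"

end

(* Write r for the radical and let f be a nonzero rational polynomial of least degree d with
   f(r) = 0.  Then f divides x^n - A, so all complex roots of f have absolute value r, and by
   Vieta r^d = |f(0) / lead_coeff f| is rational.  Irreducibility of the radical forces d >= n.
   The affine change of variable x -> a + b x preserves degrees. *)
theory Submission
  imports Defs "HOL-Computational_Algebra.Fundamental_Theorem_Algebra"
begin

lemma map_poly_of_rat_add:
  "map_poly (of_rat :: rat \<Rightarrow> 'a::field_char_0) (p + q) = map_poly of_rat p + map_poly of_rat q"
  by (simp add: poly_eq_iff coeff_map_poly of_rat_add)

lemma map_poly_of_rat_mult: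
  "map_poly (of_rat :: rat \<Rightarrow> 'a::field_char_0) (p * q) = map_poly of_rat p * map_poly of_rat q"
  by (simp add: poly_eq_iff coeff_map_poly coeff_mult of_rat_sum of_rat_mult)

lemma map_poly_of_rat_pcompose:
  "map_poly (of_rat :: rat \<Rightarrow> 'a::field_char_0) (pcompose p q)
     = pcompose (map_poly of_rat p) (map_poly of_rat q)"
  by (induction p)
    (simp_all add: pcompose_pCons map_poly_pCons map_poly_of_rat_add map_poly_of_rat_mult)

text \<open>Kept polymorphic in the field because it serves twice: over the complex numbers to
  locate all roots of a divisor, and over the reals to see that the radical itself is a
  root.\<close>

lemma poly_map_poly_of_rat_radical:
  "poly (map_poly of_rat (monom 1 n - [:A:])) (x :: 'a::field_char_0) = x ^ n - of_rat A"
proof -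
  have "map_poly of_rat (monom 1 n - [:A:]) = monom 1 n - [:of_rat A :: 'a:]"
    by (intro poly_eqI) (auto simp: coeff_map_poly of_rat_diff coeff_pCons split: nat.split)
  then show ?thesis
    by (simp add: poly_monom)
qed

lemma norm_complex_of_rat: "norm (of_rat x :: complex) = real_of_rat \<bar>x\<bar>"
proof (cases x)
  case (Fract k m)
  then have "norm (of_rat x :: complex) = \<bar>real_of_rat x\<bar>"
    by (simp add: of_rat_rat norm_divide)
  then show ?thesis
    by (simp add: abs_if of_rat_minus)
qed

text \<open>Vieta for the constant term: evaluating the factorization into linear factors at 0 gives
  the leading coefficient times the product of the negated roots, counted with multiplicity. Taking
  norms removes the signs and makes every factor equal to \<open>r\<close>.\<close>

lemma norm_coeff_0_if_norm_roots_eq: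
  fixes p :: "complex poly"
  assumes "p \<noteq> 0" and "\<And>z. poly p z = 0 \<Longrightarrow> norm z = r"
  shows "norm (coeff p 0) = norm (lead_coeff p) * r ^ degree p"
proof -
  obtain Z where size: "size Z = degree p"
    and p: "p = smult (lead_coeff p) (\<Prod>x\<in>#Z. [:-x, 1:])"
    using alg_closed_imp_factorization[OF assms(1)] by blast
  have eval: "poly p y = lead_coeff p * (\<Prod>x\<in>#Z. y - x)" for y
    by (subst p) (simp add: poly_prod_mset)
  have "norm z = r" if "z \<in># Z" for z
    using that by (intro assms(2)) (auto simp: eval)
  then have "norm (\<Prod>x\<in>#Z. - x) = r ^ size Z"
    by (induction Z) (auto simp: norm_mult)
  then show ?thesis
    using eval[of 0] by (simp add: poly_0_coeff_0 norm_mult size)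
qed

text \<open>Each complex root \<open>z\<close> of \<open>f\<close> satisfies
  \<open>z ^ n = A\<close>, so it lies on the circle of radius \<open>root n A\<close>, and the norm
  form of Vieta applies. The quotient appears because \<open>f\<close> is not normalized to be
  monic.\<close>

lemma rational_power_if_dvd_radical_poly:
  fixes f :: "rat poly"
  assumes "0 < A" and "0 < n" and dvd: "f dvd monom 1 n - [:A:]"
  shows "root n (real_of_rat A) ^ degree f = real_of_rat \<bar>coeff f 0 / lead_coeff f\<bar>"
proof -
  define r where "r = root n (real_of_rat A)"
  have r: "0 \<le> r" "r ^ n = real_of_rat A"
    using assms(1,2) by (auto simp: r_def)
  define F :: "complex poly" where "F = map_poly of_rat f"
  \<comment> \<open>As \<open>n\<close> is positive, the constant coefficient is \<open>- A\<close>,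
    which is nonzero.\<close>
  have "monom 1 n - [:A:] \<noteq> 0"
    using assms(2) by (metis poly_eq_iff coeff_diff coeff_monom coeff_pCons_0 coeff_0 assms(1)
        diff_0 neg_equal_0_iff_equal less_irrefl)
  then have "f \<noteq> 0"
    using dvd by auto
  have F: "coeff F i = of_rat (coeff f i)" for i
    by (simp add: F_def coeff_map_poly)
  have degF: "degree F = degree f"
    by (simp add: F_def degree_map_poly)
  have "F \<noteq> 0"
    using F \<open>f \<noteq> 0\<close> by (metis coeff_0 leading_coeff_0_iff of_rat_eq_0_iff)
  moreover have "norm z = r" if "poly F z = 0" for z
  proof -
    have "z ^ n = of_rat A"
      using dvd that poly_map_poly_of_rat_radical[of n A z]
      by (auto simp: F_def map_poly_of_rat_mult elim!: dvdE)
    then have "norm z ^ n = r ^ n"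
      using r(2) assms(1) by (simp add: norm_complex_of_rat flip: norm_power)
    then show ?thesis
      using r(1) assms(2) by (simp add: power_eq_iff_eq_base)
  qed
  ultimately have "norm (coeff F 0) = norm (lead_coeff F) * r ^ degree F"
    by (rule norm_coeff_0_if_norm_roots_eq)
  then have "real_of_rat \<bar>coeff f 0\<bar> = real_of_rat \<bar>lead_coeff f\<bar> * r ^ degree f"
    by (simp add: F degF norm_complex_of_rat)
  then show ?thesis
    using \<open>f \<noteq> 0\<close> by (simp add: r_def of_rat_divide field_simps)
qed

lemma irreducible_radical_degree_ge:
  fixes A :: rat and p :: "rat poly"
  assumes "0 < A" and "0 < n" and irred: "irreducible_radical n A" and "p \<noteq> 0"
    and root: "poly (map_poly real_of_rat p) (root n (real_of_rat A)) = 0"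
  shows "n \<le> degree p"
proof -
  define r where "r = root n (real_of_rat A)"
  have r: "0 < r" "r ^ n = real_of_rat A"
    using assms(1,2) by (auto simp: r_def)
  define P where "P q \<longleftrightarrow> q \<noteq> 0 \<and> poly (map_poly real_of_rat q) r = 0" for q
  have "P p"
    using assms(4) root by (simp add: P_def r_def)
  define f where "f = arg_min degree P"
  have "P f" and min: "\<And>q. P q \<Longrightarrow> degree f \<le> degree q"
    unfolding f_def using \<open>P p\<close> by (auto intro: arg_min_natI arg_min_nat_le)
  define g where "g = monom 1 n - [:A:]"
  have "map_poly real_of_rat g
      = map_poly real_of_rat (g div f) * map_poly real_of_rat f + map_poly real_of_rat (g mod f)"
    by (metis div_mult_mod_eq map_poly_of_rat_add map_poly_of_rat_mult)
  moreover have "poly (map_poly real_of_rat g) r = 0"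
    by (simp add: g_def poly_map_poly_of_rat_radical r)
  ultimately have "poly (map_poly real_of_rat (g mod f)) r = 0"
    using \<open>P f\<close> by (simp add: P_def)
  \<comment> \<open>A nonzero remainder would vanish at \<open>r\<close> and have smaller degree
    than \<open>f\<close>, against the minimality of \<open>f\<close>.\<close>
  then have "g mod f = 0"
    using min[of "g mod f"] \<open>P f\<close> degree_mod_less[of f g] unfolding P_def by fastforce
  then have "f dvd monom 1 n - [:A:]"
    by (auto simp: g_def)
  from rational_power_if_dvd_radical_poly[OF assms(1,2) this] obtain B
    where B: "r ^ degree f = real_of_rat B"
    by (auto simp: r_def)
  \<comment> \<open>The exponent \<open>m\<close> in \<open>irreducible_radical\<close> must be at
    least 1; a nonzero constant has no root, so \<open>degree f\<close> qualifies.\<close>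
  have "degree f \<noteq> 0"
  proof
    assume "degree f = 0"
    then obtain c where "f = [:c:]"
      by (rule degree_eq_zeroE)
    then show False
      using \<open>P f\<close> by (simp add: P_def map_poly_pCons)
  qed
  moreover have "0 < B"
    using B r(1) by (metis zero_less_power zero_less_of_rat_iff)
  moreover have "r = root (degree f) (real_of_rat B)"
    using r(1) \<open>degree f \<noteq> 0\<close> by (simp flip: B add: real_root_power_cancel)
  \<comment> \<open>Otherwise \<open>m = degree f\<close> and this \<open>B\<close> would violate
    irreducibility of the radical.\<close>
  ultimately have "n \<le> degree f"
    using irred unfolding irreducible_radical_def r_def
    by (metis One_nat_def Suc_leI neq0_conv not_le)
  then show ?thesis
    using min[OF \<open>P p\<close>] by simp
qed

theorem mainTheorem5:
  fixes A a b :: rat and n :: nat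
  assumes "0 < A" and "2 \<le> n" and "irreducible_radical n A" and "b \<noteq> 0"
  shows "\<not> (\<exists>p :: rat poly. p \<noteq> 0 \<and> degree p < n \<and>
           poly (map_poly real_of_rat p) (real_of_rat a + real_of_rat b * root n (real_of_rat A)) = 0)"
proof
  assume "\<exists>p :: rat poly. p \<noteq> 0 \<and> degree p < n \<and>
           poly (map_poly real_of_rat p) (real_of_rat a + real_of_rat b * root n (real_of_rat A)) = 0"
  then obtain p :: "rat poly" where p: "p \<noteq> 0" "degree p < n"
    "poly (map_poly real_of_rat p) (real_of_rat a + real_of_rat b * root n (real_of_rat A)) = 0"
    by blast
  \<comment> \<open>Since \<open>b\<close> is nonzero, the inner polynomial has degree 1, and
    composing with a nonconstant polynomial cannot annihilate \<open>p\<close>.\<close>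
  have "pcompose p [:a, b:] \<noteq> 0"
    using p(1) assms(4) by (simp add: pcompose_eq_0_iff)
  moreover have "poly (map_poly real_of_rat (pcompose p [:a, b:])) (root n (real_of_rat A)) = 0"
    using p(3)
    by (simp add: map_poly_of_rat_pcompose poly_pcompose map_poly_pCons mult.commute)
  ultimately have "n \<le> degree (pcompose p [:a, b:])"
    using assms(1-3) by (intro irreducible_radical_degree_ge) auto
  with p(2) assms(4) show False
    by (simp add: degree_pcompose)
qed

end
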